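(* Let $m$ and $n$ be positive integers. The following three statements are true. (i) The set $\Sigma:=\{(\mathcal{Q},K,\lambda)\in\mathcal{F}_{m,n}\times\mathscr{C}(\mathbb{R}^n)\times\mathbb{R} : \lambda\in\sigma(\mathcal{Q},K)\}$ is closed in the product space $\mathcal{F}_{m,n}\times\mathscr{C}(\mathbb{R}^n)\times\mathbb{R}$. In particular, for any $(\bar{\mathcal{Q}},\bar K)\in\mathcal{F}_{m,n}\times\mathscr{C}(\mathbb{R}^n)$, $\sigma(\bar{\mathcal{Q}},\bar K)$ is a closed subset of $\mathbb{R}$. (ii) Let $(\bar{\mathcal{Q}},\bar K)\in\mathcal{F}_{m,n}\times\mathscr{C}(\mathbb{R}^n)$. If $\bar{\mathcal{Q}}$ is $\bar K$-regular, then the mapping $\sigma:\mathcal{F}_{m,n}\times\mathscr{C}(\mathbb{R}^n)\to 2^{\mathbb{R}}$ is locally bounded at $(\bar{\mathcal{Q}},\bar K)$, i.e., $\bigcup_{(\mathcal{Q},K)\in\mathcal{N}}\sigma(\mathcal{Q},K)$ is bounded for some neighborhood $\mathcal{N}$ of $(\bar{\mathcal{Q}},\bar K)$. (iii) Let $(\bar{\mathcal{Q}},\bar K)\in\mathcal{F}_{m,n}\times\mathscr{C}(\mathbb{R}^n)$. If $\bar{\mathcal{Q}}$ is $\bar K$-regular, then $\sigma$ is upper-semicontinuous at $(\bar{\mathcal{Q}},\bar K)$.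
   Context: $\mathcal{T}_{m,n}$ is the space of real $m$-th order $n$-dimensional tensors $\mathcal{A}=(a_{i_1\ldots i_m})$, $1\le i_1,\ldots,i_m\le n$, with no symmetry assumed. For $x\in\mathbb{R}^n$, $\mathcal{A}x^{m-1}\in\mathbb{R}^n$ has $i$-th component $\sum_{i_2,\ldots,i_m=1}^n a_{ii_2\ldots i_m}x_{i_2}\cdots x_{i_m}$, and $\mathcal{A}x^m=\langle x,\mathcal{A}x^{m-1}\rangle=\sum_{i_1,\ldots,i_m}a_{i_1\ldots i_m}x_{i_1}\cdots x_{i_m}$. $\mathcal{F}_{m,n}=\mathcal{T}_{m,n}\times\mathcal{T}_{m,n}\times\mathcal{T}_{m,n}$ is equipped with the distance $\|\mathcal{Q}_1-\mathcal{Q}_2\|_F=(\|\mathcal{A}_1-\mathcal{A}_2\|_F^2+\|\mathcal{B}_1-\mathcal{B}_2\|_F^2+\|\mathcal{C}_1-\mathcal{C}_2\|_F^2)^{1/2}$ for $\mathcal{Q}_i=(\mathcal{A}_i,\mathcal{B}_i,\mathcal{C}_i)$, where $\|\mathcal{A}\|_F=(\sum a_{i_1\ldots i_m}^2)^{1/2}$. $\mathscr{C}(\mathbb{R}^n)$ is the set of nonzero closed convex cones in $\mathbb{R}^n$ (closed convex cones different from $\{0\}$), with the metric $\delta(K_1,K_2)=\sup_{\|z\|\le 1}|\mathrm{dist}(z,K_1)-\mathrm{dist}(z,K_2)|$, where $\mathrm{dist}(z,K)=\inf_{u\in K}\|z-u\|$. The dual cone is $K^*=\{y\in\mathbb{R}^n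 : \langle y,x\rangle\ge 0\ \forall x\in K\}$. For $\mathcal{Q}=(\mathcal{A},\mathcal{B},\mathcal{C})\in\mathcal{F}_{m,n}$ and $K\in\mathscr{C}(\mathbb{R}^n)$, the $m$-degree $K$-spectrum $\sigma(\mathcal{Q},K)$ is the set of all $\lambda\in\mathbb{R}$ for which there is $x\in\mathbb{R}^n\setminus\{0\}$ with $x\in K$, $(\lambda^m\mathcal{A}+\lambda\mathcal{B}+\mathcal{C})x^{m-1}\in K^*$ and $\langle x,(\lambda^m\mathcal{A}+\lambda\mathcal{B}+\mathcal{C})x^{m-1}\rangle=0$. $\mathcal{Q}=(\mathcal{A},\mathcal{B},\mathcal{C})$ is called $K$-regular if $\mathcal{A}x^m\ne 0$ for all $x\in K\setminus\{0\}$. A set-valued map $\Psi:W\to 2^Y$ between topological spaces is upper-semicontinuous at $\bar w\in W$ if for every open $U\subset Y$ with $\Psi(\bar w)\subset U$ there is a neighborhood $N$ of $\bar w$ such that $\Psi(w)\subset U$ for all $w\in N$.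
   Formalization: Parts (ii) and (iii) are stated for m ≥ 2 only; for m = 1 they are false: with n = 1, K = R₊, A = 1, B = −1, C = 1 the triple is K-regular with empty spectrum, but B = −1+e gives the eigenvalue −1/e for every e ≠ 0. *)

theory Defs
  imports "HOL-Analysis.Analysis"
begin

section \<open>Tensors\<close>

(* The order m of a tensor is CARD('m) and its dimension is CARD('n).  An entry is indexed by a
   multi-index of type 'n ^ 'm (a map from the m index positions to the n coordinates).  The linear
   order on 'm serves only to single out the first position, Min UNIV.  Every finite cardinality is
   attained by such an 'm, e.g. by the numeral types. *)
type_synonym ('m, 'n) tensor = "real ^ ('n ^ 'm)"

type_synonym ('m, 'n) tensor_triple = "('m, 'n) tensor \<times> ('m, 'n) tensor \<times> ('m, 'n) tensor"

definition tensor_apply :: "('m::{finite,linorder}, 'n::finite) tensor \<Rightarrow> real ^ 'n \<Rightarrow> real ^ 'n" where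
  "tensor_apply A x =
     (\<chi> i. \<Sum>\<alpha> | \<alpha> $ Min UNIV = i. A $ \<alpha> * (\<Prod>j\<in>UNIV - {Min UNIV}. x $ (\<alpha> $ j)))"

definition tensor_form :: "('m::{finite,linorder}, 'n::finite) tensor \<Rightarrow> real ^ 'n \<Rightarrow> real" where
  "tensor_form A x = x \<bullet> tensor_apply A x"

lemma tensor_form_eq:
  fixes A :: "('m::{finite,linorder}, 'n::finite) tensor"
  shows "tensor_form A x = (\<Sum>\<alpha>\<in>UNIV. A $ \<alpha> * (\<Prod>j\<in>UNIV. x $ (\<alpha> $ j)))"
proof -
  have "tensor_form A x = (\<Sum>i\<in>UNIV. \<Sum>\<alpha> | \<alpha> \<in> UNIV \<and> \<alpha> $ Min UNIV = i.
          x $ (\<alpha> $ Min UNIV) * (A $ \<alpha> * (\<Prod>j\<in>UNIV - {Min UNIV}. x $ (\<alpha> $ j))))"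
    unfolding tensor_form_def tensor_apply_def inner_vec_def
    by (intro sum.cong refl) (simp add: sum_distrib_left)
  also have "\<dots> = (\<Sum>\<alpha>\<in>UNIV. x $ (\<alpha> $ Min UNIV) * (A $ \<alpha> * (\<Prod>j\<in>UNIV - {Min UNIV}. x $ (\<alpha> $ j))))"
    by (rule sum.group) auto
  also have "\<dots> = (\<Sum>\<alpha>\<in>UNIV. A $ \<alpha> * (\<Prod>j\<in>UNIV. x $ (\<alpha> $ j)))"
    by (intro sum.cong refl) (subst prod.remove[of UNIV "Min UNIV"], auto)
  finally show ?thesis .
qed

(* The library norm and metric on these types are the Frobenius norm and the induced distance. *)
lemma norm_tensor:
  fixes A :: "('m::finite, 'n::finite) tensor"
  shows "norm A = sqrt (\<Sum>\<alpha>\<in>UNIV. (A $ \<alpha>)\<^sup>2)"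
  by (simp add: norm_vec_def L2_set_def)

lemma dist_tensor_triple:
  fixes A1 B1 C1 A2 B2 C2 :: "('m::finite, 'n::finite) tensor"
  shows "dist (A1, B1, C1) (A2, B2, C2) =
    sqrt ((norm (A1 - A2))\<^sup>2 + (norm (B1 - B2))\<^sup>2 + (norm (C1 - C2))\<^sup>2)"
  by (simp add: dist_prod_def dist_norm add.assoc)


section \<open>The metric space of nonzero closed convex cones\<close>

typedef (overloaded) 'n ccone =
  "{K :: (real ^ 'n::finite) set. closed K \<and> convex_cone K \<and> K \<noteq> {0}}"
  morphisms set_of_ccone Abs_ccone
proof
  have "axis undefined 1 \<noteq> (0 :: real ^ 'n)" by simp
  then have "(UNIV :: (real ^ 'n) set) \<noteq> {0}" by blast
  then show "UNIV \<in> {K :: (real ^ 'n) set. closed K \<and> convex_cone K \<and> K \<noteq> {0}}"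
    by (simp add: convex_cone_def conic_def)
qed

lemma closed_set_of_ccone: "closed (set_of_ccone K)"
  and convex_cone_set_of_ccone: "convex_cone (set_of_ccone K)"
  and set_of_ccone_neq: "set_of_ccone K \<noteq> {0}"
  using set_of_ccone[of K] by auto

lemma scale_in_ccone: "x \<in> set_of_ccone K \<Longrightarrow> 0 \<le> c \<Longrightarrow> c *\<^sub>R x \<in> set_of_ccone K"
  using convex_cone_set_of_ccone[of K] by (simp add: convex_cone_def conic_def)

lemma zero_in_ccone: "0 \<in> set_of_ccone K"
  using convex_cone_set_of_ccone[of K] scale_in_ccone[of _ K 0]
  by (force simp: convex_cone_def)

instantiation ccone :: (finite) metric_space
begin

definition dist_ccone :: "'a ccone \<Rightarrow> 'a ccone \<Rightarrow> real" where
  "dist_ccone K1 K2 =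
     (SUP z\<in>cball 0 1. \<bar>infdist z (set_of_ccone K1) - infdist z (set_of_ccone K2)\<bar>)"

definition uniformity_ccone :: "('a ccone \<times> 'a ccone) filter" where
  "uniformity_ccone = (INF e\<in>{0 <..}. principal {(x, y). dist x y < e})"

definition open_ccone :: "'a ccone set \<Rightarrow> bool" where
  "open_ccone S = (\<forall>x\<in>S. \<forall>\<^sub>F (x', y) in uniformity. x' = x \<longrightarrow> y \<in> S)"

lemma infdist_diff_le_dist_ccone:
  fixes K1 K2 :: "'a ccone"
  assumes "norm z \<le> 1"
  shows "\<bar>infdist z (set_of_ccone K1) - infdist z (set_of_ccone K2)\<bar> \<le> dist K1 K2"
  unfolding dist_ccone_def
proof (rule cSUP_upper)
  show "z \<in> cball 0 1" using assms by simp
  have le1: "infdist z (set_of_ccone K) \<le> 1" if "z \<in> cball 0 1" for z and K :: "'a ccone"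
    using infdist_le[OF zero_in_ccone, of z K] that by simp
  show "bdd_above ((\<lambda>z. \<bar>infdist z (set_of_ccone K1) - infdist z (set_of_ccone K2)\<bar>) ` cball 0 1)"
  proof (rule bdd_aboveI2)
    fix z :: "real ^ 'a" assume "z \<in> cball 0 1"
    then show "\<bar>infdist z (set_of_ccone K1) - infdist z (set_of_ccone K2)\<bar> \<le> 1"
      using le1[of z K1] le1[of z K2] infdist_nonneg[of z "set_of_ccone K1"]
        infdist_nonneg[of z "set_of_ccone K2"] by linarith
  qed
qed

instance
proof
  fix K1 K2 K3 :: "'a ccone"
  have sub: "set_of_ccone L1 \<subseteq> set_of_ccone L2" if d: "dist L1 L2 = 0" for L1 L2 :: "'a ccone"
  proof
    fix x assume x: "x \<in> set_of_ccone L1"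
    define c where "c = 1 + norm x"
    have c: "c > 0" unfolding c_def by (simp add: add_pos_nonneg)
    define z where "z = (1 / c) *\<^sub>R x"
    have "z \<in> set_of_ccone L1" unfolding z_def using x c by (intro scale_in_ccone) auto
    moreover have "norm z \<le> 1" unfolding z_def using c by (simp add: c_def)
    ultimately have "infdist z (set_of_ccone L2) = 0"
      using infdist_diff_le_dist_ccone[of z L1 L2] d by simp
    then have "z \<in> set_of_ccone L2"
      using in_closed_iff_infdist_zero[OF closed_set_of_ccone, of L2 z] zero_in_ccone[of L2] by auto
    then have "c *\<^sub>R z \<in> set_of_ccone L2" using c by (intro scale_in_ccone) auto
    then show "x \<in> set_of_ccone L2" using c by (simp add: z_def)
  qed
  have comm: "dist L1 L2 = dist L2 L1" for L1 L2 :: "'a ccone"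
    unfolding dist_ccone_def by (simp add: abs_minus_commute)
  show "dist K1 K2 = 0 \<longleftrightarrow> K1 = K2"
  proof
    assume "dist K1 K2 = 0"
    then have "set_of_ccone K1 = set_of_ccone K2"
      using sub[of K1 K2] sub[of K2 K1] comm[of K1 K2] by auto
    then show "K1 = K2" by (simp add: set_of_ccone_inject)
  next
    assume "K1 = K2"
    then show "dist K1 K2 = 0" by (simp add: dist_ccone_def)
  qed
  show "dist K1 K2 \<le> dist K1 K3 + dist K2 K3"
    unfolding dist_ccone_def[of K1 K2]
  proof (rule cSUP_least)
    fix z :: "real ^ 'a" assume "z \<in> cball 0 1"
    then have "norm z \<le> 1" by simp
    then show "\<bar>infdist z (set_of_ccone K1) - infdist z (set_of_ccone K2)\<bar> \<le> dist K1 K3 + dist K2 K3"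
      using infdist_diff_le_dist_ccone[of z K1 K3] infdist_diff_le_dist_ccone[of z K2 K3] by linarith
  qed simp
qed (rule open_ccone_def uniformity_ccone_def)+

end


section \<open>Spectrum, regularity, and set-valued maps\<close>

definition dual_cone :: "'a::real_inner set \<Rightarrow> 'a set" where
  "dual_cone K = {y. \<forall>x\<in>K. y \<bullet> x \<ge> 0}"

definition tensor_pencil :: "('m::{finite,linorder}, 'n::finite) tensor_triple \<Rightarrow> real \<Rightarrow> ('m, 'n) tensor" where
  "tensor_pencil Q \<mu> = (case Q of (A, B, C) \<Rightarrow> \<mu> ^ CARD('m) *\<^sub>R A + \<mu> *\<^sub>R B + C)"

definition spectrum :: "('m::{finite,linorder}, 'n::finite) tensor_triple \<Rightarrow> 'n ccone \<Rightarrow> real set" where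
  "spectrum Q K = {\<mu>. \<exists>x. x \<noteq> 0 \<and> x \<in> set_of_ccone K \<and>
     tensor_apply (tensor_pencil Q \<mu>) x \<in> dual_cone (set_of_ccone K) \<and>
     x \<bullet> tensor_apply (tensor_pencil Q \<mu>) x = 0}"

definition cone_regular :: "('m::{finite,linorder}, 'n::finite) tensor_triple \<Rightarrow> 'n ccone \<Rightarrow> bool" where
  "cone_regular Q K \<longleftrightarrow> (case Q of (A, B, C) \<Rightarrow> \<forall>x\<in>set_of_ccone K - {0}. tensor_form A x \<noteq> 0)"

definition locally_bounded_at :: "('w::topological_space \<Rightarrow> 'y::metric_space set) \<Rightarrow> 'w \<Rightarrow> bool" where
  "locally_bounded_at \<Psi> w \<longleftrightarrow> (\<exists>N. open N \<and> w \<in> N \<and> bounded (\<Union>v\<in>N. \<Psi> v))"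

definition upper_semicontinuous_at ::
    "('w::topological_space \<Rightarrow> 'y::topological_space set) \<Rightarrow> 'w \<Rightarrow> bool" where
  "upper_semicontinuous_at \<Psi> w \<longleftrightarrow>
     (\<forall>U. open U \<and> \<Psi> w \<subseteq> U \<longrightarrow> (\<exists>N. open N \<and> w \<in> N \<and> (\<forall>v\<in>N. \<Psi> v \<subseteq> U)))"


section \<open>Order one\<close>

(* For m = 1 the coefficient of lambda in the pencil is A + B, over which regularity (a condition
   on A alone) has no control.  Hence regularity implies neither local boundedness nor upper
   semicontinuity of the spectrum in that case. *)

lemma tensor_apply_order_one:
  fixes A :: "('m::{finite,linorder}, 'n::finite) tensor"
  assumes "CARD('m) = 1"
  shows "tensor_apply A x = (\<chi> i. A $ (\<chi> j. i))"
proof -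
  have U: "j = Min UNIV" for j :: 'm
    using assms by (metis UNIV_I card_1_singletonE singletonD)
  have "{\<alpha>. \<alpha> $ (Min UNIV :: 'm) = i} = {\<chi> j. i}" for i :: 'n
    using U by (auto simp: vec_eq_iff) metis
  moreover have "UNIV - {Min UNIV} = ({} :: 'm set)" using U by auto
  ultimately show ?thesis by (simp add: tensor_apply_def assms)
qed

lemma order_one_counterexample:
  assumes "CARD('m::{finite,linorder}) = 1"
  shows "\<exists>(Q :: ('m::{finite,linorder}, 'n::finite) tensor_triple) K. cone_regular Q K \<and>
    \<not> locally_bounded_at (\<lambda>(Q :: ('m, 'n) tensor_triple, K). spectrum Q K) (Q, K) \<and>
    \<not> upper_semicontinuous_at (\<lambda>(Q :: ('m, 'n) tensor_triple, K). spectrum Q K) (Q, K)"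
proof -
  define P :: "(real ^ 'n) set" where "P = {x. \<forall>i. x $ i \<ge> 0}"
  have "closed P"
    unfolding P_def by (intro closed_Collect_all closed_Collect_le continuous_intros)
  moreover have "convex_cone P"
    by (auto simp: convex_cone_def convex_def conic_def P_def intro!: exI[of _ 0])
  moreover have 1: "1 \<in> P" by (simp add: P_def)
  moreover have "P \<noteq> {0}" using 1 by (metis singletonD zero_neq_one)
  ultimately obtain K where K: "set_of_ccone K = P"
    using Abs_ccone_inverse[of P] by blast
  define Q where "Q e = ((1, (e - 1) *\<^sub>R 1, 1) :: ('m, 'n) tensor_triple)" for e :: real
  have pencil: "tensor_apply (tensor_pencil (Q e) \<mu>) x = (\<chi> i. \<mu> * e + 1)" for e \<mu> x
    by (simp add: tensor_apply_order_one[OF assms] assms tensor_pencil_def Q_def vec_eq_iff algebra_simps)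
  have reg: "cone_regular (Q 0) K"
    unfolding cone_regular_def Q_def K
  proof clarsimp
    fix x assume "x \<in> P" "x \<noteq> 0" "tensor_form (1 :: ('m, 'n) tensor) x = 0"
    then have "(\<Sum>i\<in>UNIV. x $ i) = 0"
      by (simp add: tensor_form_def tensor_apply_order_one[OF assms] inner_vec_def)
    with \<open>x \<in> P\<close> have "\<forall>i. x $ i = 0" by (simp add: P_def sum_nonneg_eq_0_iff)
    with \<open>x \<noteq> 0\<close> show False by (simp add: vec_eq_iff)
  qed
  have empty: "spectrum (Q 0) K = {}"
  proof (rule ccontr)
    assume "spectrum (Q 0) K \<noteq> {}"
    then obtain x where "x \<noteq> 0" "x \<in> P" "x \<bullet> (\<chi> i. 1) = 0"
      by (auto simp: spectrum_def pencil K split: if_splits)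
    then have "(\<Sum>i\<in>UNIV. x $ i) = 0" by (simp add: inner_vec_def)
    with \<open>x \<in> P\<close> have "\<forall>i. x $ i = 0" by (simp add: P_def sum_nonneg_eq_0_iff)
    with \<open>x \<noteq> 0\<close> show False by (simp add: vec_eq_iff)
  qed
  have mem: "- 1 / e \<in> spectrum (Q e) K" if "e \<noteq> 0" for e
    unfolding spectrum_def K mem_Collect_eq pencil using that 1
    by (intro exI[of _ 1]) (simp add: dual_cone_def inner_vec_def)
  have near: "\<exists>d>0. \<forall>e. \<bar>e\<bar> < d \<longrightarrow> (Q e, K) \<in> N" if "open N" "(Q 0, K) \<in> N" for N
  proof -
    have "isCont (\<lambda>e. (Q e, K)) 0" unfolding Q_def by (intro continuous_intros)
    then have "((\<lambda>e. (Q e, K)) \<longlongrightarrow> (Q 0, K)) (at 0)" by (simp add: isCont_def)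
    then have "\<forall>\<^sub>F e in at 0. (Q e, K) \<in> N" using that by (rule topological_tendstoD)
    then obtain d where "d > 0" "\<forall>e. e \<noteq> 0 \<and> \<bar>e\<bar> < d \<longrightarrow> (Q e, K) \<in> N"
      by (auto simp: eventually_at dist_real_def)
    with that show ?thesis by metis
  qed
  have "\<not> locally_bounded_at (\<lambda>(Q, K). spectrum Q K) (Q 0, K)"
  proof
    assume "locally_bounded_at (\<lambda>(Q, K). spectrum Q K) (Q 0, K)"
    then obtain N where N: "open N" "(Q 0, K) \<in> N" "bounded (\<Union>v\<in>N. case v of (Q, K) \<Rightarrow> spectrum Q K)"
      by (auto simp: locally_bounded_at_def)
    then obtain b where b: "\<And>Q' K' l. (Q', K') \<in> N \<Longrightarrow> l \<in> spectrum Q' K' \<Longrightarrow> \<bar>l\<bar> \<le> b"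
      by (fastforce simp: bounded_iff)
    obtain d where d: "d > 0" "\<And>e. \<bar>e\<bar> < d \<Longrightarrow> (Q e, K) \<in> N" using near N by blast
    define e where "e = min (d / 2) (1 / (\<bar>b\<bar> + 1))"
    have e: "0 < e" "e < d" "e \<le> 1 / (\<bar>b\<bar> + 1)" using d(1) unfolding e_def by (auto simp: add_nonneg_pos)
    then have "\<bar>- 1 / e\<bar> \<le> b" using b[OF d(2)[of e] mem[of e]] by simp
    then have "1 / e \<le> b" using e(1) by simp
    moreover have "\<bar>b\<bar> + 1 \<le> 1 / e" using e(1,3) by (simp add: field_simps)
    ultimately show False by linarith
  qed
  moreover have "\<not> upper_semicontinuous_at (\<lambda>(Q, K). spectrum Q K) (Q 0, K)"
  proof
    assume "upper_semicontinuous_at (\<lambda>(Q, K). spectrum Q K) (Q 0, K)"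
    then obtain N where N: "open N" "(Q 0, K) \<in> N" "\<forall>v\<in>N. (case v of (Q, K) \<Rightarrow> spectrum Q K) \<subseteq> {}"
      unfolding upper_semicontinuous_at_def using empty by (metis case_prod_conv empty_subsetI open_empty)
    obtain d where d: "d > 0" "\<And>e. \<bar>e\<bar> < d \<Longrightarrow> (Q e, K) \<in> N" using near N by blast
    have "(Q (d / 2), K) \<in> N" using d by simp
    moreover have "- 1 / (d / 2) \<in> spectrum (Q (d / 2)) K" using d(1) by (intro mem) simp
    ultimately show False using N(3) by fastforce
  qed
  ultimately show ?thesis using reg by blast
qed

end

theory Submission
  imports Defs
begin

text \<open>
Membership in a closed convex cone \<open>K\<close> and in its dual can both be read off the distance function:
\<open>x \<in> K\<close> iff \<open>infdist x K = 0\<close>, and \<open>w \<in> K\<^sup>*\<close> iff \<open>infdist (- w) K = norm w\<close>, that is, iff the origin is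
the point of \<open>K\<close> nearest to \<open>- w\<close>. The metric on cones is a uniform distance between distance functions
on the unit ball, and these functions are positively homogeneous, so \<open>infdist z K\<close> is jointly continuous in
\<open>z\<close> and \<open>K\<close> (\<open>continuous_on_infdist_ccone\<close>). Hence \<open>x \<in> K\<close>, \<open>P x\<^sup>m\<^sup>-\<^sup>1 \<in> K\<^sup>*\<close> and \<open>P x\<^sup>m = 0\<close> are
closed conditions on \<open>(P, K, x)\<close>. They are invariant under positive scaling of \<open>x\<close>, so an eigenvector
may be sought on the unit sphere. Projecting along that compact sphere, the pairs \<open>(P, K)\<close> that admit a
nonzero solution form a closed set (\<open>closed_complementarity_pairs\<close>), and the graph of the spectrum is the
preimage of this set under the continuous map that sends \<open>(Q, K, \<mu>)\<close> to the pencil of \<open>Q\<close> at \<open>\<mu>\<close>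
paired with \<open>K\<close>.

For local boundedness, an eigenvalue escaping to infinity is moved to \<open>s = 1 / \<mu>\<close> near \<open>0\<close>. The pencil
multiplied by \<open>s\<^sup>m\<close> is \<open>A + s\<^sup>m\<^sup>-\<^sup>1 B + s\<^sup>m C\<close>, which for \<open>m \<ge> 2\<close> depends continuously on \<open>s\<close> and equals
\<open>A\<close> at \<open>s = 0\<close>. The factor \<open>s\<^sup>m\<close> may be negative, which destroys the dual cone condition, but the
weaker condition that the form of the tensor vanishes at some unit vector of the cone survives any scaling.
It is again closed, and regularity says that \<open>(A, K)\<close> violates it; so does every nearby pair, and therefore
the rescaled pencil for all nearby \<open>Q\<close>, \<open>K\<close> and all small \<open>s\<close> (\<open>locally_bounded_at_spectrum\<close>).

A locally bounded set-valued map into the reals with closed graph is upper semicontinuous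
(\<open>upper_semicontinuous_at_if_closed_graph\<close>), which gives the last claim.
\<close>

section \<open>Projection along a compact factor\<close>

text \<open>Over a point outside the projection the whole slice avoids \<open>S\<close>, and by compactness so does a tube
  around that slice. The base space is arbitrary because the space of cones carries no linear structure.\<close>
lemma closed_projection_along_compact:
  fixes S :: "('a::topological_space \<times> 'b::topological_space) set"
  assumes "closed S" "compact C"
  shows "closed {a. \<exists>b\<in>C. (a, b) \<in> S}"
proof -
  have "open (- {a. \<exists>b\<in>C. (a, b) \<in> S})"
  proof (subst open_subopen, intro ballI)
    fix a assume "a \<in> - {a. \<exists>b\<in>C. (a, b) \<in> S}"
    then have "{a} \<times> C \<subseteq> - S" by auto
    from Elementary_Topology.tube_lemma[OF \<open>compact C\<close> open_Compl[OF \<open>closed S\<close>] this]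
    show "\<exists>N. open N \<and> a \<in> N \<and> N \<subseteq> - {a. \<exists>b\<in>C. (a, b) \<in> S}"
      by blast
  qed
  then show ?thesis by (simp add: closed_open)
qed

text \<open>The values near \<open>w\<close> lie in one compact set. The part of it outside \<open>U\<close> is compact, so the points
  whose value meets that part form a closed set, and \<open>w\<close> is not among them.\<close>
lemma upper_semicontinuous_at_if_closed_graph:
  fixes \<Psi> :: "'w::topological_space \<Rightarrow> 'y::heine_borel set"
  assumes graph: "closed {(v, y). y \<in> \<Psi> v}"
    and bdd: "locally_bounded_at \<Psi> w"
  shows "upper_semicontinuous_at \<Psi> w"
  unfolding upper_semicontinuous_at_def
proof (intro allI impI, elim conjE)
  fix U assume U: "open U" "\<Psi> w \<subseteq> U"
  obtain N where N: "open N" "w \<in> N" "bounded (\<Union>v\<in>N. \<Psi> v)"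
    using bdd by (auto simp: locally_bounded_at_def)
  define C where "C = closure (\<Union>v\<in>N. \<Psi> v) - U"
  define Z where "Z = {v. \<exists>y\<in>C. (v, y) \<in> {(v, y). y \<in> \<Psi> v}}"
  have "compact C"
    unfolding C_def using N(3) U(1) by (intro compact_diff) (simp_all add: compact_closure)
  then have "closed Z"
    unfolding Z_def using graph by (intro closed_projection_along_compact)
  show "\<exists>M. open M \<and> w \<in> M \<and> (\<forall>v\<in>M. \<Psi> v \<subseteq> U)"
  proof (intro exI[of _ "N - Z"] conjI ballI)
    show "open (N - Z)" using N(1) \<open>closed Z\<close> by (rule open_Diff)
    show "w \<in> N - Z" using N(2) U(2) by (auto simp: Z_def C_def)
    show "\<Psi> v \<subseteq> U" if "v \<in> N - Z" for v
      using that closure_subset[of "\<Union>v\<in>N. \<Psi> v"] by (auto simp: Z_def C_def)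
  qed
qed


section \<open>Distance to a varying cone\<close>

lemma infdist_scale_ccone:
  assumes "c > 0"
  shows "infdist (c *\<^sub>R z) (set_of_ccone K) = c * infdist z (set_of_ccone K)"
proof -
  have le: "infdist (c *\<^sub>R z) (set_of_ccone K) \<le> c * infdist z (set_of_ccone K)"
    if "c > 0" for c :: real and z
  proof -
    have ne: "set_of_ccone K \<noteq> {}" using zero_in_ccone by blast
    have "infdist (c *\<^sub>R z) (set_of_ccone K) / c \<le> infdist z (set_of_ccone K)"
      unfolding infdist_notempty[OF ne, of z]
    proof (rule cINF_greatest[OF ne])
      fix u assume "u \<in> set_of_ccone K"
      then have "infdist (c *\<^sub>R z) (set_of_ccone K) \<le> dist (c *\<^sub>R z) (c *\<^sub>R u)"
        using that by (intro infdist_le scale_in_ccone) auto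
      also have "\<dots> = c * dist z u"
        using that by (simp add: dist_norm flip: scaleR_diff_right)
      finally show "infdist (c *\<^sub>R z) (set_of_ccone K) / c \<le> dist z u"
        using that by (simp add: field_simps)
    qed
    then show ?thesis using that by (simp add: field_simps)
  qed
  have "infdist z (set_of_ccone K) \<le> (1 / c) * infdist (c *\<^sub>R z) (set_of_ccone K)"
    using le[of "1 / c" "c *\<^sub>R z"] assms by simp
  then show ?thesis using le[OF assms, of z] assms by (simp add: field_simps)
qed

text \<open>The metric on cones compares distances only from points of the unit ball; homogeneity carries the
  comparison to every point, at the price of a factor.\<close>
lemma infdist_diff_le_norm_mult_dist_ccone:
  "\<bar>infdist z (set_of_ccone K1) - infdist z (set_of_ccone K2)\<bar> \<le> (1 + norm z) * dist K1 K2"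
proof -
  define c where "c = 1 + norm z"
  have c: "c > 0" unfolding c_def by (simp add: add_pos_nonneg)
  define u where "u = (1 / c) *\<^sub>R z"
  have u: "norm u \<le> 1" "z = c *\<^sub>R u" using c by (simp_all add: u_def c_def)
  have "\<bar>infdist z (set_of_ccone K1) - infdist z (set_of_ccone K2)\<bar>
      = c * \<bar>infdist u (set_of_ccone K1) - infdist u (set_of_ccone K2)\<bar>"
    using c by (simp add: u(2) infdist_scale_ccone abs_mult flip: right_diff_distrib)
  also have "\<dots> \<le> c * dist K1 K2"
    using infdist_diff_le_dist_ccone[OF u(1)] c by (intro mult_left_mono) auto
  finally show ?thesis by (simp add: c_def)
qed

lemma continuous_on_infdist_ccone [continuous_intros]:
  fixes f :: "'a::topological_space \<Rightarrow> real ^ 'n::finite"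
  assumes f: "continuous_on S f" and g: "continuous_on S g"
  shows "continuous_on S (\<lambda>x. infdist (f x) (set_of_ccone (g x)))"
  unfolding continuous_on_def
proof (intro ballI, rule Lim_transform[rotated])
  fix a assume "a \<in> S"
  then have fa: "(f \<longlongrightarrow> f a) (at a within S)" and ga: "(g \<longlongrightarrow> g a) (at a within S)"
    using f g by (auto simp: continuous_on_def)
  show "((\<lambda>x. infdist (f x) (set_of_ccone (g a))) \<longlongrightarrow> infdist (f a) (set_of_ccone (g a))) (at a within S)"
    by (intro tendsto_infdist fa)
  have "((\<lambda>x. (1 + norm (f x)) * dist (g x) (g a)) \<longlongrightarrow> (1 + norm (f a)) * dist (g a) (g a)) (at a within S)"
    by (intro tendsto_intros fa ga)
  then have bound: "((\<lambda>x. (1 + norm (f x)) * dist (g x) (g a)) \<longlongrightarrow> 0) (at a within S)" by simp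
  have "norm (infdist (f x) (set_of_ccone (g x)) - infdist (f x) (set_of_ccone (g a)))
      \<le> (1 + norm (f x)) * dist (g x) (g a)" for x
    using infdist_diff_le_norm_mult_dist_ccone[of "f x" "g x" "g a"] by simp
  then show "((\<lambda>x. infdist (f x) (set_of_ccone (g x)) - infdist (f x) (set_of_ccone (g a))) \<longlongrightarrow> 0)
      (at a within S)"
    by (intro Lim_null_comparison[OF always_eventually bound] allI)
qed

lemma in_ccone_iff_infdist: "x \<in> set_of_ccone K \<longleftrightarrow> infdist x (set_of_ccone K) = 0"
  using in_closed_iff_infdist_zero[OF closed_set_of_ccone, of K x] zero_in_ccone[of K] by auto

text \<open>Both sides say that \<open>norm (w + u)\<close> is least at \<open>u = 0\<close> among the \<open>u\<close> in the cone. This turns a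
  condition that quantifies over the varying cone into one equation between continuous functions.\<close>
lemma in_dual_ccone_iff_infdist:
  "w \<in> dual_cone (set_of_ccone K) \<longleftrightarrow> infdist (- w) (set_of_ccone K) = norm w"
proof
  assume w: "w \<in> dual_cone (set_of_ccone K)"
  have ne: "set_of_ccone K \<noteq> {}" using zero_in_ccone by blast
  have "norm w \<le> infdist (- w) (set_of_ccone K)"
    unfolding infdist_notempty[OF ne]
  proof (rule cINF_greatest[OF ne])
    fix u assume "u \<in> set_of_ccone K"
    then have "w \<bullet> u \<ge> 0" using w by (simp add: dual_cone_def)
    then have "(norm w)\<^sup>2 \<le> (norm (w + u))\<^sup>2"
      by (simp add: power2_norm_eq_inner inner_simps inner_commute)
    then have "norm w \<le> norm (w + u)" by (rule power2_le_imp_le) simp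
    also have "\<dots> = dist (- w) u" by (metis dist_minus dist_norm diff_minus_eq_add minus_minus)
    finally show "norm w \<le> dist (- w) u" .
  qed
  moreover have "infdist (- w) (set_of_ccone K) \<le> norm w"
    using infdist_le[OF zero_in_ccone, of "- w" K] by simp
  ultimately show "infdist (- w) (set_of_ccone K) = norm w" by simp
next
  assume eq: "infdist (- w) (set_of_ccone K) = norm w"
  have "w \<bullet> u \<ge> 0" if u: "u \<in> set_of_ccone K" for u
  proof (rule ccontr)
    assume neg: "\<not> w \<bullet> u \<ge> 0"
    then have uu: "u \<bullet> u > 0" by (cases "u = 0") auto
    \<comment> \<open>the minimizer of \<open>norm (w + t *\<^sub>R u)\<close> along the ray through \<open>u\<close>\<close>
    define t where "t = - (w \<bullet> u) / (u \<bullet> u)"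
    have t: "t > 0" using neg uu by (simp add: t_def divide_neg_pos)
    have "norm w \<le> dist (- w) (t *\<^sub>R u)"
      using infdist_le[OF scale_in_ccone[OF u, of t], of "- w"] t eq by simp
    also have "\<dots> = norm (w + t *\<^sub>R u)" by (metis dist_minus dist_norm diff_minus_eq_add minus_minus)
    finally have "(norm w)\<^sup>2 \<le> (norm (w + t *\<^sub>R u))\<^sup>2" by (simp add: power_mono)
    then have "0 \<le> t * (2 * (w \<bullet> u) + t * (u \<bullet> u))"
      by (simp add: power2_norm_eq_inner inner_simps inner_commute algebra_simps)
    then have "0 \<le> 2 * (w \<bullet> u) + t * (u \<bullet> u)" using t by (simp add: zero_le_mult_iff)
    moreover have "t * (u \<bullet> u) = - (w \<bullet> u)" using uu by (simp add: t_def)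
    ultimately show False using neg by simp
  qed
  then show "w \<in> dual_cone (set_of_ccone K)" by (simp add: dual_cone_def)
qed


section \<open>Tensor polynomials\<close>

lemma continuous_on_tensor_apply [continuous_intros]:
  fixes f :: "'a::topological_space \<Rightarrow> ('m::{finite,linorder}, 'n::finite) tensor"
  assumes "continuous_on S f" "continuous_on S g"
  shows "continuous_on S (\<lambda>x. tensor_apply (f x) (g x))"
  unfolding tensor_apply_def by (intro continuous_intros assms)

lemma tensor_apply_scale_vector:
  fixes A :: "('m::{finite,linorder}, 'n::finite) tensor"
  shows "tensor_apply A (c *\<^sub>R x) = c ^ (CARD('m) - 1) *\<^sub>R tensor_apply A x"
  by (simp add: tensor_apply_def vec_eq_iff prod.distrib card_Diff_singleton sum_distrib_left mult_ac)

lemma tensor_form_scale_tensor: "tensor_form (c *\<^sub>R A) x = c * tensor_form A x"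
  by (simp add: tensor_form_eq sum_distrib_left mult_ac)


section \<open>Closed sets of pairs of a tensor and a cone\<close>

text \<open>Normalizing the solution \<open>x\<close> to the unit sphere keeps it away from \<open>0\<close> in limits.\<close>
definition complementarity_pairs :: "(('m::{finite,linorder}, 'n::finite) tensor \<times> 'n ccone) set" where
  "complementarity_pairs = {(P, K). \<exists>x\<in>sphere 0 1. x \<in> set_of_ccone K \<and>
     tensor_apply P x \<in> dual_cone (set_of_ccone K) \<and> tensor_form P x = 0}"

text \<open>Dropping the dual cone condition makes the set invariant under scaling the tensor by any real number,
  in contrast to \<open>complementarity_pairs\<close>, which a negative factor need not preserve.\<close>
definition isotropic_pairs :: "(('m::{finite,linorder}, 'n::finite) tensor \<times> 'n ccone) set" where
  "isotropic_pairs = {(P, K). \<exists>x\<in>sphere 0 1. x \<in> set_of_ccone K \<and> tensor_form P x = 0}"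

lemma closed_complementarity_pairs:
  "closed (complementarity_pairs :: (('m::{finite,linorder}, 'n::finite) tensor \<times> 'n ccone) set)"
proof -
  let ?S = "{v :: (('m, 'n) tensor \<times> 'n ccone) \<times> (real ^ 'n).
    infdist (snd v) (set_of_ccone (snd (fst v))) = 0 \<and>
    infdist (- tensor_apply (fst (fst v)) (snd v)) (set_of_ccone (snd (fst v)))
      = norm (tensor_apply (fst (fst v)) (snd v)) \<and>
    snd v \<bullet> tensor_apply (fst (fst v)) (snd v) = 0}"
  have "closed ?S" by (intro closed_Collect_conj closed_Collect_eq continuous_intros)
  then have "closed {p. \<exists>x\<in>sphere 0 1. (p, x) \<in> ?S}"
    by (intro closed_projection_along_compact) simp_all
  also have "{p. \<exists>x\<in>sphere 0 1. (p, x) \<in> ?S} = complementarity_pairs"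
    by (auto simp: complementarity_pairs_def tensor_form_def in_dual_ccone_iff_infdist
        simp flip: in_ccone_iff_infdist)
  finally show ?thesis .
qed

lemma closed_isotropic_pairs:
  "closed (isotropic_pairs :: (('m::{finite,linorder}, 'n::finite) tensor \<times> 'n ccone) set)"
proof -
  let ?S = "{v :: (('m, 'n) tensor \<times> 'n ccone) \<times> (real ^ 'n).
    infdist (snd v) (set_of_ccone (snd (fst v))) = 0 \<and>
    snd v \<bullet> tensor_apply (fst (fst v)) (snd v) = 0}"
  have "closed ?S" by (intro closed_Collect_conj closed_Collect_eq continuous_intros)
  then have "closed {p. \<exists>x\<in>sphere 0 1. (p, x) \<in> ?S}"
    by (intro closed_projection_along_compact) simp_all
  also have "{p. \<exists>x\<in>sphere 0 1. (p, x) \<in> ?S} = isotropic_pairs"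
    by (auto simp: isotropic_pairs_def tensor_form_def simp flip: in_ccone_iff_infdist)
  finally show ?thesis .
qed

lemma complementarity_pairs_subset_isotropic_pairs: "complementarity_pairs \<subseteq> isotropic_pairs"
  by (auto simp: complementarity_pairs_def isotropic_pairs_def)

lemma isotropic_pairs_scale: "(P, K) \<in> isotropic_pairs \<Longrightarrow> (c *\<^sub>R P, K) \<in> isotropic_pairs"
  by (auto simp: isotropic_pairs_def tensor_form_scale_tensor)

lemma cone_regular_not_isotropic:
  assumes "cone_regular (A, B, C) K"
  shows "(A, K) \<notin> isotropic_pairs"
  using assms by (auto simp: cone_regular_def isotropic_pairs_def)

lemma spectrum_iff_complementarity_pairs:
  fixes Q :: "('m::{finite,linorder}, 'n::finite) tensor_triple"
  shows "\<mu> \<in> spectrum Q K \<longleftrightarrow> (tensor_pencil Q \<mu>, K) \<in> complementarity_pairs"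
proof
  assume "\<mu> \<in> spectrum Q K"
  then obtain x where x: "x \<noteq> 0" "x \<in> set_of_ccone K"
      "tensor_apply (tensor_pencil Q \<mu>) x \<in> dual_cone (set_of_ccone K)"
      "x \<bullet> tensor_apply (tensor_pencil Q \<mu>) x = 0"
    by (auto simp: spectrum_def)
  let ?u = "(1 / norm x) *\<^sub>R x"
  have "?u \<in> set_of_ccone K" using x by (intro scale_in_ccone) auto
  moreover have "tensor_apply (tensor_pencil Q \<mu>) ?u \<in> dual_cone (set_of_ccone K)"
    using x(3) by (simp only: tensor_apply_scale_vector) (simp add: dual_cone_def)
  moreover have "tensor_form (tensor_pencil Q \<mu>) ?u = 0"
    using x(4) by (simp only: tensor_form_def tensor_apply_scale_vector) simp
  moreover have "?u \<in> sphere 0 1" using x(1) by simp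
  ultimately show "(tensor_pencil Q \<mu>, K) \<in> complementarity_pairs"
    unfolding complementarity_pairs_def by blast
next
  assume "(tensor_pencil Q \<mu>, K) \<in> complementarity_pairs"
  then obtain x where x: "norm x = 1" "x \<in> set_of_ccone K"
      "tensor_apply (tensor_pencil Q \<mu>) x \<in> dual_cone (set_of_ccone K)"
      "x \<bullet> tensor_apply (tensor_pencil Q \<mu>) x = 0"
    by (auto simp: complementarity_pairs_def tensor_form_def)
  then have "x \<noteq> 0" by auto
  with x show "\<mu> \<in> spectrum Q K" unfolding spectrum_def by blast
qed


section \<open>The spectral map\<close>

lemma closed_spectrum_graph:
  "closed {((Q :: ('m::{finite,linorder}, 'n::finite) tensor_triple, K :: 'n ccone), \<mu>). \<mu> \<in> spectrum Q K}"
proof -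
  let ?h = "\<lambda>v :: (('m, 'n) tensor_triple \<times> 'n ccone) \<times> real.
    (snd v ^ CARD('m) *\<^sub>R fst (fst (fst v)) + snd v *\<^sub>R fst (snd (fst (fst v))) + snd (snd (fst (fst v))),
     snd (fst v))"
  have "closed (?h -` complementarity_pairs)"
    by (intro closed_vimage closed_complementarity_pairs continuous_intros)
  also have "?h -` complementarity_pairs = {((Q, K), \<mu>). \<mu> \<in> spectrum Q K}"
    by (auto simp: spectrum_iff_complementarity_pairs tensor_pencil_def)
  finally show ?thesis .
qed

text \<open>The left-hand side is a polynomial in \<open>s = 1 / \<mu>\<close>, so it extends continuously to \<open>s = 0\<close>, the place
  of an infinite eigenvalue.\<close>
lemma reversed_pencil:
  fixes A B C :: "('m::{finite,linorder}, 'n::finite) tensor"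
  assumes "\<mu> \<noteq> 0"
  shows "A + (1 / \<mu>) ^ (CARD('m) - 1) *\<^sub>R B + (1 / \<mu>) ^ CARD('m) *\<^sub>R C
    = (1 / \<mu>) ^ CARD('m) *\<^sub>R tensor_pencil (A, B, C) \<mu>"
proof -
  obtain k where "CARD('m) = Suc k" using not0_implies_Suc[of "CARD('m)"] by auto
  then show ?thesis using assms by (simp add: tensor_pencil_def scaleR_add_right power_one_over)
qed

text \<open>The order bound makes \<open>s ^ (m - 1)\<close> vanish at \<open>s = 0\<close>, so that the reversed pencil there is the
  leading tensor alone, which is what regularity constrains. The pairs \<open>(Q', K')\<close> and numbers \<open>s\<close> whose
  reversed pencil is not isotropic form an open set; a box in it around \<open>((Q, K), 0)\<close> forbids
  eigenvalues of absolute value above the inverse of its radius in \<open>s\<close>.\<close>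
lemma locally_bounded_at_spectrum:
  fixes Q :: "('m::{finite,linorder}, 'n::finite) tensor_triple"
  assumes "CARD('m) \<ge> 2" "cone_regular Q K"
  shows "locally_bounded_at (\<lambda>(Q', K'). spectrum Q' K') (Q, K)"
proof -
  let ?h = "\<lambda>v :: (('m, 'n) tensor_triple \<times> 'n ccone) \<times> real.
    (fst (fst (fst v)) + snd v ^ (CARD('m) - 1) *\<^sub>R fst (snd (fst (fst v)))
       + snd v ^ CARD('m) *\<^sub>R snd (snd (fst (fst v))),
     snd (fst v))"
  let ?W = "- (?h -` isotropic_pairs)"
  have "open ?W"
    by (intro open_Compl closed_vimage closed_isotropic_pairs continuous_intros)
  moreover have "((Q, K), 0) \<in> ?W"
  proof -
    obtain A B C where Q: "Q = (A, B, C)" by (cases Q)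
    then have "(A, K) \<notin> isotropic_pairs" using assms(2) cone_regular_not_isotropic by blast
    then show ?thesis using assms(1) by (simp add: Q power_0_left)
  qed
  ultimately obtain N I where NI: "open N" "open I" "(Q, K) \<in> N" "0 \<in> I" "N \<times> I \<subseteq> ?W"
    by (rule open_prod_elim) auto
  obtain e where e: "e > 0" "\<And>s. \<bar>s\<bar> < e \<Longrightarrow> s \<in> I"
    using NI(2,4) by (auto simp: open_dist dist_real_def)
  have bound: "\<bar>\<mu>\<bar> \<le> 1 / e" if v: "(Q', K') \<in> N" "\<mu> \<in> spectrum Q' K'" for Q' K' \<mu>
  proof (rule ccontr)
    assume large: "\<not> \<bar>\<mu>\<bar> \<le> 1 / e"
    then have "\<mu> \<noteq> 0" using e(1) by auto
    have "\<bar>1 / \<mu>\<bar> < e" using large e(1) \<open>\<mu> \<noteq> 0\<close> by (simp add: field_simps)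
    then have "((Q', K'), 1 / \<mu>) \<in> ?W" using NI(5) v(1) e(2) by blast
    then have "((1 / \<mu>) ^ CARD('m) *\<^sub>R tensor_pencil Q' \<mu>, K') \<notin> isotropic_pairs"
      by (cases Q') (simp del: power_one_over flip: reversed_pencil[OF \<open>\<mu> \<noteq> 0\<close>])
    moreover have "(tensor_pencil Q' \<mu>, K') \<in> isotropic_pairs"
      using v(2) complementarity_pairs_subset_isotropic_pairs
      by (auto simp: spectrum_iff_complementarity_pairs)
    ultimately show False using isotropic_pairs_scale by blast
  qed
  have "bounded (\<Union>v\<in>N. case v of (Q', K') \<Rightarrow> spectrum Q' K')"
    unfolding bounded_iff using bound by (intro exI[of _ "1 / e"]) auto
  then show ?thesis unfolding locally_bounded_at_def using NI(1,3) by blast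
qed

theorem proposition2p1:
  shows "(closed {(Q :: ('m::{finite,linorder}, 'n::finite) tensor_triple, K :: 'n ccone, \<mu>).
            \<mu> \<in> spectrum Q K} \<and>
          (\<forall>(Q :: ('m, 'n) tensor_triple) K. closed (spectrum Q K))) \<and>
         (\<forall>(Q :: ('m, 'n) tensor_triple) K. CARD('m) \<ge> 2 \<longrightarrow> cone_regular Q K \<longrightarrow>
            locally_bounded_at (\<lambda>(Q', K'). spectrum Q' K') (Q, K)) \<and>
         (\<forall>(Q :: ('m, 'n) tensor_triple) K. CARD('m) \<ge> 2 \<longrightarrow> cone_regular Q K \<longrightarrow>
            upper_semicontinuous_at (\<lambda>(Q', K'). spectrum Q' K') (Q, K))"
proof -
  let ?G = "{((Q :: ('m, 'n) tensor_triple, K :: 'n ccone), \<mu>). \<mu> \<in> spectrum Q K}"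
  have "closed ((\<lambda>v :: ('m, 'n) tensor_triple \<times> 'n ccone \<times> real.
      ((fst v, fst (snd v)), snd (snd v))) -` ?G)"
    by (intro closed_vimage closed_spectrum_graph continuous_intros)
  also have "(\<lambda>v :: ('m, 'n) tensor_triple \<times> 'n ccone \<times> real.
      ((fst v, fst (snd v)), snd (snd v))) -` ?G = {(Q, K, \<mu>). \<mu> \<in> spectrum Q K}"
    by auto
  finally have joint: "closed {(Q :: ('m, 'n) tensor_triple, K :: 'n ccone, \<mu>). \<mu> \<in> spectrum Q K}" .
  have slices: "closed (spectrum Q K)" for Q :: "('m, 'n) tensor_triple" and K
  proof -
    have "closed ((\<lambda>\<mu>. ((Q, K), \<mu>)) -` ?G)"
      by (intro closed_vimage closed_spectrum_graph continuous_intros)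
    also have "(\<lambda>\<mu>. ((Q, K), \<mu>)) -` ?G = spectrum Q K" by auto
    finally show ?thesis .
  qed
  have usc: "upper_semicontinuous_at (\<lambda>(Q', K'). spectrum Q' K') (Q, K)"
    if "CARD('m) \<ge> 2" "cone_regular Q K" for Q :: "('m, 'n) tensor_triple" and K
  proof (rule upper_semicontinuous_at_if_closed_graph)
    show "closed {(v, \<mu>). \<mu> \<in> (case v of (Q' :: ('m, 'n) tensor_triple, K') \<Rightarrow> spectrum Q' K')}"
      using closed_spectrum_graph by (simp add: case_prod_unfold)
    show "locally_bounded_at (\<lambda>(Q', K'). spectrum Q' K') (Q, K)"
      using that by (rule locally_bounded_at_spectrum)
  qed
  show ?thesis by (intro conjI joint) (use slices locally_bounded_at_spectrum usc in auto)
qed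

end
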